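(* Any intersection graph of grounded L-shapes on $n$ vertices has a biclique cover of size $O(n\log^3 n)$; that is, there is an absolute constant $C$ such that every intersection graph of a grounded set of $n\ge 2$ L-shapes has a biclique cover of size at most $C\,n\log^3 n$.
   Context: All graphs are finite and simple. A biclique is a complete bipartite graph. A biclique cover of a graph $G$ is a collection $\mathcal{H}$ of (not necessarily induced) subgraphs of $G$, each of which is a biclique, such that every edge of $G$ belongs to at least one member of $\mathcal{H}$. The size of $\mathcal{H}$ is $\sum_{H\in\mathcal{H}}|V(H)|$. An L-shape is a subset of the plane that is the union of a horizontal segment and a vertical segment such that the left endpoint of the horizontal segment is the bottom endpoint of the vertical segment; this common point is the corner of the L-shape. A set of L-shapes is grounded if the corners of all the L-shapes in the set lie on the same negatively-sloped line. The intersection graph of a set of L-shapes has the L-shapes as vertices, two distinct ones being adjacent if and only if they have nonempty intersection. *)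

theory Defs
  imports "HOL-Analysis.Analysis" "Graph_Theory.Graph_Theory"
begin

text \<open>
  Finite simple graphs are the symmetric, loop-free, finite digraphs of \<^locale>\<open>pair_graph\<close>: an edge
  between \<open>u\<close> and \<open>v\<close> is represented by the two arcs \<open>(u, v)\<close> and \<open>(v, u)\<close>.
\<close>

definition biclique :: "'a pair_pre_digraph \<Rightarrow> bool" where
  "biclique H \<longleftrightarrow> (\<exists>m n. m > 0 \<and> n > 0 \<and> complete_bipartite_digraph m n (with_proj H))"

definition biclique_cover :: "'a pair_pre_digraph \<Rightarrow> 'a pair_pre_digraph set \<Rightarrow> bool" where
  "biclique_cover G \<H> \<longleftrightarrow>
     (\<forall>H\<in>\<H>. subgraph (with_proj H) (with_proj G) \<and> biclique H) \<and>
     (\<forall>e\<in>parcs G. \<exists>H\<in>\<H>. e \<in> parcs H)"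

definition cover_size :: "'a pair_pre_digraph set \<Rightarrow> nat" where
  "cover_size \<H> = (\<Sum>H\<in>\<H>. card (pverts H))"

text \<open>Covers of finite graphs are finite, so \<^const>\<open>cover_size\<close> is a genuine sum.\<close>

lemma biclique_cover_finite:
  assumes "pair_graph G" "biclique_cover G \<H>"
  shows "finite \<H>"
proof -
  interpret pair_graph G by fact
  have "\<H> \<subseteq> (\<lambda>(V, A). \<lparr>pverts = V, parcs = A\<rparr>) ` (Pow (pverts G) \<times> Pow (parcs G))"
  proof
    fix H assume "H \<in> \<H>"
    then have "pverts H \<subseteq> pverts G" "parcs H \<subseteq> parcs G"
      using assms(2) by (auto simp: biclique_cover_def subgraph_def with_proj_def)
    then show "H \<in> (\<lambda>(V, A). \<lparr>pverts = V, parcs = A\<rparr>) ` (Pow (pverts G) \<times> Pow (parcs G))"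
      by (intro image_eqI[of _ _ "(pverts H, parcs H)"]) auto
  qed
  then show ?thesis
    by (rule finite_subset) (simp add: pair_finite_verts pair_finite_arcs)
qed

definition intersection_graph :: "'a set set \<Rightarrow> 'a set pair_pre_digraph" where
  "intersection_graph S =
     \<lparr>pverts = S, parcs = {(A, B). A \<in> S \<and> B \<in> S \<and> A \<noteq> B \<and> A \<inter> B \<noteq> {}}\<rparr>"

lemma pair_graph_intersection_graph:
  assumes "finite S"
  shows "pair_graph (intersection_graph S)"
proof -
  have "finite {(A, B). A \<in> S \<and> B \<in> S \<and> A \<noteq> B \<and> A \<inter> B \<noteq> {}}"
    by (rule finite_subset[of _ "S \<times> S"]) (use assms in auto)
  then show ?thesis
    using assms
    by unfold_locales
      (auto simp: intersection_graph_def symmetric_def arcs_ends_def arc_to_ends_def intro!: symI)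
qed

definition L_shape_with_corner :: "real \<times> real \<Rightarrow> (real \<times> real) set \<Rightarrow> bool" where
  "L_shape_with_corner p L \<longleftrightarrow>
     (\<exists>a b. a > 0 \<and> b > 0 \<and>
        L = closed_segment p (p + (a, 0)) \<union> closed_segment p (p + (0, b)))"

definition L_shape :: "(real \<times> real) set \<Rightarrow> bool" where
  "L_shape L \<longleftrightarrow> (\<exists>p. L_shape_with_corner p L)"

lemma L_shape_corner_unique:
  assumes "L_shape_with_corner p L" "L_shape_with_corner q L"
  shows "p = q"
proof -
  have "p \<in> L \<and> (\<forall>r\<in>L. fst p \<le> fst r \<and> snd p \<le> snd r)" if "L_shape_with_corner p L" for p
  proof -
    from that obtain a b where ab: "a > 0" "b > 0"
      "L = closed_segment p (p + (a, 0)) \<union> closed_segment p (p + (0, b))"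
      by (auto simp: L_shape_with_corner_def)
    then show ?thesis
      by (cases p) (auto simp: in_segment algebra_simps)
  qed
  from this[OF assms(1)] this[OF assms(2)] show ?thesis
    by (meson antisym prod_eqI)
qed

definition grounded :: "(real \<times> real) set set \<Rightarrow> bool" where
  "grounded S \<longleftrightarrow>
     (\<exists>m c. m < 0 \<and> (\<forall>L\<in>S. \<exists>x y. L_shape_with_corner (x, y) L \<and> y = m * x + c))"

end

theory Submission
  imports Defs
begin

text \<open>
  Parametrise the ground line by the first coordinate, and let the L-shape with corner \<open>x\<close> reach
  from \<open>l\<close> to \<open>r\<close>, where \<open>r\<close> is the first coordinate of the end of the horizontal segment, and \<open>l\<close>
  that of the point of the line level with the top of the vertical segment. For \<open>x\<^sub>i \<le> x\<^sub>j\<close>, the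
  L-shapes \<open>i\<close> and \<open>j\<close> meet iff \<open>x\<^sub>j \<le> r\<^sub>i\<close> and \<open>l\<^sub>j \<le> x\<^sub>i\<close>. Together with the ordering of the corners
  this describes adjacency by three comparisons, each between a value of \<open>i\<close> and a value of \<open>j\<close>.
  Each comparison is resolved by divide and conquer, which costs one logarithmic factor: split at the
  median, recurse on both halves, and between the lower and the upper half the comparison always
  holds in one direction and never in the other, so that only the other comparisons remain.
\<close>

section \<open>Covering relations by full rectangles\<close>

text \<open>The two sides are separate sets because the recursion cuts them independently. Both
  sides of a rectangle are nonempty, as those of a biclique must be; their disjointness is left to
  the relation.\<close>

definition rectangle_cover ::
  "('a \<Rightarrow> 'b \<Rightarrow> bool) \<Rightarrow> 'a set \<Rightarrow> 'b set \<Rightarrow> ('a set \<times> 'b set) set \<Rightarrow> bool" where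
  "rectangle_cover R A B P \<longleftrightarrow> finite P \<and>
     (\<forall>(X, Y)\<in>P. X \<noteq> {} \<and> Y \<noteq> {} \<and> X \<subseteq> A \<and> Y \<subseteq> B \<and> (\<forall>x\<in>X. \<forall>y\<in>Y. R x y)) \<and>
     (\<forall>a\<in>A. \<forall>b\<in>B. R a b \<longrightarrow> (\<exists>(X, Y)\<in>P. a \<in> X \<and> b \<in> Y))"

definition weight :: "('a set \<times> 'b set) set \<Rightarrow> nat" where
  "weight P = (\<Sum>(X, Y)\<in>P. card X + card Y)"

lemma weight_Un_le:
  assumes "finite P" "finite Q"
  shows "weight (P \<union> Q) \<le> weight P + weight Q"
  using assms by (simp add: weight_def sum_Un_nat)

lemma rectangle_cover_covers:
  assumes "rectangle_cover R A B P" "a \<in> A" "b \<in> B" "R a b"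
  obtains X Y where "(X, Y) \<in> P" "a \<in> X" "b \<in> Y"
  using assms unfolding rectangle_cover_def by blast

lemma rectangle_cover_cong:
  assumes "\<And>a b. a \<in> A \<Longrightarrow> b \<in> B \<Longrightarrow> R a b \<longleftrightarrow> R' a b"
  shows "rectangle_cover R A B P \<longleftrightarrow> rectangle_cover R' A B P"
proof -
  have "(X \<subseteq> A \<and> Y \<subseteq> B \<and> (\<forall>x\<in>X. \<forall>y\<in>Y. R x y)) \<longleftrightarrow> (X \<subseteq> A \<and> Y \<subseteq> B \<and> (\<forall>x\<in>X. \<forall>y\<in>Y. R' x y))"
    for X Y using assms by blast
  moreover have "(\<forall>a\<in>A. \<forall>b\<in>B. R a b \<longrightarrow> (\<exists>(X, Y)\<in>P. a \<in> X \<and> b \<in> Y)) \<longleftrightarrow>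
      (\<forall>a\<in>A. \<forall>b\<in>B. R' a b \<longrightarrow> (\<exists>(X, Y)\<in>P. a \<in> X \<and> b \<in> Y))"
    using assms by (simp cong: ball_cong)
  ultimately show ?thesis
    unfolding rectangle_cover_def by simp
qed

lemma rectangle_cover_empty:
  assumes "A = {} \<or> B = {}"
  shows "rectangle_cover R A B {}"
  using assms by (auto simp: rectangle_cover_def)

lemma rectangle_cover_full:
  "\<exists>P. rectangle_cover (\<lambda>_ _. True) A B P \<and> weight P \<le> card A + card B"
proof (cases "A = {} \<or> B = {}")
  case True
  then show ?thesis
    by (intro exI[of _ "{}"]) (simp add: rectangle_cover_empty weight_def)
next
  case False
  then show ?thesis
    by (intro exI[of _ "{(A, B)}"]) (auto simp: rectangle_cover_def weight_def)
qed

text \<open>Of the four blocks, \<open>A\<^sub>2\<close> against \<open>B\<^sub>1\<close> contains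
  no related pair, so covers of the other three suffice.\<close>

lemma rectangle_cover_split:
  assumes "rectangle_cover R A\<^sub>1 B\<^sub>1 P\<^sub>1" "rectangle_cover R A\<^sub>2 B\<^sub>2 P\<^sub>2" "rectangle_cover R A\<^sub>1 B\<^sub>2 Q"
    and "\<And>a b. a \<in> A\<^sub>2 \<Longrightarrow> b \<in> B\<^sub>1 \<Longrightarrow> \<not> R a b"
  shows "rectangle_cover R (A\<^sub>1 \<union> A\<^sub>2) (B\<^sub>1 \<union> B\<^sub>2) (P\<^sub>1 \<union> P\<^sub>2 \<union> Q)"
proof -
  have fin: "finite (P\<^sub>1 \<union> P\<^sub>2 \<union> Q)"
    using assms by (simp add: rectangle_cover_def)
  have rect: "X \<noteq> {}" "Y \<noteq> {}" "X \<subseteq> A\<^sub>1 \<union> A\<^sub>2" "Y \<subseteq> B\<^sub>1 \<union> B\<^sub>2" "\<forall>x\<in>X. \<forall>y\<in>Y. R x y"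
    if "(X, Y) \<in> P\<^sub>1 \<union> P\<^sub>2 \<union> Q" for X Y
    using that assms(1-3) unfolding rectangle_cover_def by fast+
  have covers: "\<exists>(X, Y)\<in>P\<^sub>1 \<union> P\<^sub>2 \<union> Q. a \<in> X \<and> b \<in> Y"
    if ab: "a \<in> A\<^sub>1 \<union> A\<^sub>2" "b \<in> B\<^sub>1 \<union> B\<^sub>2" "R a b" for a b
  proof -
    consider "a \<in> A\<^sub>1" "b \<in> B\<^sub>1" | "a \<in> A\<^sub>2" "b \<in> B\<^sub>2" | "a \<in> A\<^sub>1" "b \<in> B\<^sub>2"
      using ab assms(4) by blast
    then have "\<exists>Z. (Z \<in> P\<^sub>1 \<or> Z \<in> P\<^sub>2 \<or> Z \<in> Q) \<and> a \<in> fst Z \<and> b \<in> snd Z"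
      using rectangle_cover_covers[OF assms(1) _ _ ab(3)]
        rectangle_cover_covers[OF assms(2) _ _ ab(3)]
        rectangle_cover_covers[OF assms(3) _ _ ab(3)]
      by cases (metis fst_conv snd_conv)+
    then show ?thesis by auto
  qed
  show ?thesis
    unfolding rectangle_cover_def
  proof (intro conjI ballI impI fin)
    fix Z assume "Z \<in> P\<^sub>1 \<union> P\<^sub>2 \<union> Q"
    then show "case Z of (X, Y) \<Rightarrow> X \<noteq> {} \<and> Y \<noteq> {} \<and> X \<subseteq> A\<^sub>1 \<union> A\<^sub>2 \<and> Y \<subseteq> B\<^sub>1 \<union> B\<^sub>2 \<and>
        (\<forall>x\<in>X. \<forall>y\<in>Y. R x y)"
      using rect[of "fst Z" "snd Z"] by (simp add: split_beta)
  qed (rule covers)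
qed

text \<open>Merge the values of \<open>f\<close> and \<open>g\<close> into one sorted list, with
  elements of \<open>A\<close> first among equal values; \<open>A'\<close> and \<open>B'\<close>
  form its first \<open>m\<close> entries. The induction appends one entry at a time.\<close>

lemma threshold_split:
  fixes f :: "'a \<Rightarrow> 'k::linorder" and g :: "'b \<Rightarrow> 'k"
  assumes "finite A" "finite B" "m \<le> card A + card B"
  shows "\<exists>A'\<subseteq>A. \<exists>B'\<subseteq>B. card A' + card B' = m \<and>
    (\<forall>a\<in>A'. \<forall>b\<in>B - B'. f a \<le> g b) \<and> (\<forall>a\<in>A - A'. \<forall>b\<in>B'. g b < f a)"
  using assms(3)
proof (induction m)
  case 0
  show ?case by (intro exI[of _ "{}"]) auto
next
  case (Suc m)
  then obtain A' B' where AB: "A' \<subseteq> A" "B' \<subseteq> B" "card A' + card B' = m"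
    "\<forall>a\<in>A'. \<forall>b\<in>B - B'. f a \<le> g b" "\<forall>a\<in>A - A'. \<forall>b\<in>B'. g b < f a"
    by fastforce
  have fin: "finite A'" "finite B'"
    using AB assms finite_subset by blast+
  show ?case
  \<comment> \<open>The next entry may be any such \<open>a\<close>, since elements of
    \<open>A\<close> need not be ordered among themselves. If there is none, a remaining
    \<open>b\<close> of least value lies strictly below every remaining \<open>a\<close>.\<close>
  proof (cases "\<exists>a\<in>A - A'. \<forall>b\<in>B - B'. f a \<le> g b")
    case True
    then obtain a where a: "a \<in> A - A'" "\<forall>b\<in>B - B'. f a \<le> g b" by blast
    show ?thesis
      by (rule exI[of _ "insert a A'"], intro conjI, use AB a in blast,
          rule exI[of _ B'], use AB a fin in auto)
  next
    case False
    have "A' \<noteq> A \<or> B' \<noteq> B"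
      using AB Suc.prems by auto
    \<comment> \<open>If \<open>B\<close> were exhausted, any remaining \<open>a\<close> would
      satisfy the case condition vacuously.\<close>
    then have "B - B' \<noteq> {}"
      using False AB by blast
    then have "Min (g ` (B - B')) \<in> g ` (B - B')"
      using assms by (intro Min_in) auto
    then obtain b where b: "b \<in> B - B'" "g b = Min (g ` (B - B'))"
      by auto
    then have "g b \<le> g b'" if "b' \<in> B - B'" for b'
      using that assms by simp
    then have "g b < f a" if "a \<in> A - A'" for a
      using False that by (meson leI order.strict_trans1)
    then show ?thesis
      by (intro exI[of _ A'] conjI AB, intro exI[of _ "insert b B'"]) (use AB b fin in auto)
  qed
qed

text \<open>After a split, the two parts recurse at depth \<open>d - 1\<close>, and the cross block
  needs a cover of \<open>R\<close> alone. Each level thus adds one cover of \<open>R\<close>, which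
  raises the exponent by one. \<open>base\<close> quantifies over all sets and depths because every
  cross block is a new instance of it.\<close>

lemma rectangle_cover_compare:
  fixes f :: "'a \<Rightarrow> 'k::linorder" and g :: "'b \<Rightarrow> 'k"
  assumes base: "\<And>(A::'a set) (B::'b set) d. finite A \<Longrightarrow> finite B \<Longrightarrow> card A + card B \<le> 2 ^ d \<Longrightarrow>
      \<exists>P. rectangle_cover R A B P \<and> weight P \<le> (card A + card B) * (d + 1) ^ k"
    and "finite A" "finite B" "card A + card B \<le> 2 ^ d"
  shows "\<exists>P. rectangle_cover (\<lambda>a b. R a b \<and> f a \<le> g b) A B P \<and>
    weight P \<le> (card A + card B) * (d + 1) ^ Suc k"
  using assms(2-4)
proof (induction d arbitrary: A B)
  case 0
  \<comment> \<open>At most one element remains in total, so there is no pair to cover.\<close>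
  then have "A = {} \<or> B = {}"
    by (metis One_nat_def Suc_n_not_le_n add_mono card_0_eq not_less_eq_eq one_add_one
        numeral_2_eq_2 power_0 zero_le le_zero_eq)
  then show ?case
    using rectangle_cover_empty by (intro exI[of _ "{}"]) (simp add: weight_def rectangle_cover_empty)
next
  case (Suc d)
  \<comment> \<open>Cutting at \<open>2 ^ d\<close> instead of the exact median leaves at most
    \<open>2 ^ d\<close> elements in either part; for smaller inputs the second part is
    empty.\<close>
  define m where "m = min (2 ^ d) (card A + card B)"
  obtain A\<^sub>1 B\<^sub>1 where AB: "A\<^sub>1 \<subseteq> A" "B\<^sub>1 \<subseteq> B" "card A\<^sub>1 + card B\<^sub>1 = m"
    "\<forall>a\<in>A\<^sub>1. \<forall>b\<in>B - B\<^sub>1. f a \<le> g b" "\<forall>a\<in>A - A\<^sub>1. \<forall>b\<in>B\<^sub>1. g b < f a"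
    using threshold_split[of A B m f g] Suc.prems by (auto simp: m_def)
  define A\<^sub>2 B\<^sub>2 where "A\<^sub>2 = A - A\<^sub>1" and "B\<^sub>2 = B - B\<^sub>1"
  have fin: "finite A\<^sub>1" "finite B\<^sub>1" "finite A\<^sub>2" "finite B\<^sub>2"
    using AB Suc.prems finite_subset unfolding A\<^sub>2_def B\<^sub>2_def by blast+
  have cA: "card A = card A\<^sub>1 + card A\<^sub>2" and cB: "card B = card B\<^sub>1 + card B\<^sub>2"
    using AB Suc.prems fin unfolding A\<^sub>2_def B\<^sub>2_def
    by (simp_all add: card_Diff_subset card_mono)
  let ?R = "\<lambda>a b. R a b \<and> f a \<le> g b"
  obtain P\<^sub>1 where P1: "rectangle_cover ?R A\<^sub>1 B\<^sub>1 P\<^sub>1"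
    "weight P\<^sub>1 \<le> (card A\<^sub>1 + card B\<^sub>1) * (d + 1) ^ Suc k"
    using Suc.IH[of A\<^sub>1 B\<^sub>1] AB fin by (auto simp: m_def)
  obtain P\<^sub>2 where P2: "rectangle_cover ?R A\<^sub>2 B\<^sub>2 P\<^sub>2"
    "weight P\<^sub>2 \<le> (card A\<^sub>2 + card B\<^sub>2) * (d + 1) ^ Suc k"
    using Suc.IH[of A\<^sub>2 B\<^sub>2] AB fin Suc.prems cA cB by (auto simp: m_def min_def split: if_splits)
  obtain Q where Q: "rectangle_cover R A\<^sub>1 B\<^sub>2 Q"
    "weight Q \<le> (card A\<^sub>1 + card B\<^sub>2) * (Suc d + 1) ^ k"
    using base[of A\<^sub>1 B\<^sub>2 "Suc d"] fin Suc.prems cA cB by auto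
  \<comment> \<open>The new comparison holds for every pair of this block.\<close>
  have "rectangle_cover ?R A\<^sub>1 B\<^sub>2 Q"
    using Q(1) AB(4) by (subst rectangle_cover_cong[where R' = R]) (auto simp: B\<^sub>2_def)
  then have "rectangle_cover ?R (A\<^sub>1 \<union> A\<^sub>2) (B\<^sub>1 \<union> B\<^sub>2) (P\<^sub>1 \<union> P\<^sub>2 \<union> Q)"
    using P1 P2 AB(5) by (intro rectangle_cover_split) (auto simp: A\<^sub>2_def not_le)
  then have "rectangle_cover ?R A B (P\<^sub>1 \<union> P\<^sub>2 \<union> Q)"
    using AB by (simp add: A\<^sub>2_def B\<^sub>2_def Un_absorb1)
  moreover have "weight (P\<^sub>1 \<union> P\<^sub>2 \<union> Q) \<le> (card A + card B) * (Suc d + 1) ^ Suc k"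
  proof -
    have finP: "finite P\<^sub>1" "finite P\<^sub>2" "finite Q"
      using P1 P2 Q by (auto simp: rectangle_cover_def)
    have "weight (P\<^sub>1 \<union> P\<^sub>2 \<union> Q) \<le> weight P\<^sub>1 + weight P\<^sub>2 + weight Q"
      using weight_Un_le[of "P\<^sub>1 \<union> P\<^sub>2" Q] weight_Un_le[of P\<^sub>1 P\<^sub>2] finP by simp
    also have "\<dots> \<le> (card A\<^sub>1 + card B\<^sub>1) * (d + 1) ^ Suc k + (card A\<^sub>2 + card B\<^sub>2) * (d + 1) ^ Suc k
        + (card A\<^sub>1 + card B\<^sub>2) * (Suc d + 1) ^ k"
      using P1 P2 Q by linarith
    also have "\<dots> \<le> (card A + card B) * (d + 1) ^ Suc k + (card A + card B) * (Suc d + 1) ^ k"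
      by (intro add_mono mult_right_mono) (simp_all add: cA cB algebra_simps)
    also have "\<dots> = (card A + card B) * ((d + 1) * (d + 1) ^ k + (Suc d + 1) ^ k)"
      by (simp add: algebra_simps)
    \<comment> \<open>Enlarging the base of the first power makes the coefficients
      \<open>d + 1\<close> and \<open>1\<close> add up to \<open>Suc d + 1\<close>.\<close>
    also have "\<dots> \<le> (card A + card B) * ((d + 1) * (Suc d + 1) ^ k + (Suc d + 1) ^ k)"
      by (intro mult_left_mono add_mono power_mono order_refl) auto
    also have "\<dots> = (card A + card B) * (Suc d + 1) ^ Suc k"
      by (simp add: algebra_simps)
    finally show ?thesis .
  qed
  ultimately show ?case by blast
qed

lemma rectangle_cover_three_comparisons:
  fixes f\<^sub>1 f\<^sub>2 f\<^sub>3 :: "'a \<Rightarrow> 'k::linorder" and g\<^sub>1 g\<^sub>2 g\<^sub>3 :: "'b \<Rightarrow> 'k"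
  assumes "finite A" "finite B" "card A + card B \<le> 2 ^ d"
  shows "\<exists>P. rectangle_cover (\<lambda>a b. f\<^sub>1 a \<le> g\<^sub>1 b \<and> f\<^sub>2 a \<le> g\<^sub>2 b \<and> f\<^sub>3 a \<le> g\<^sub>3 b) A B P \<and>
    weight P \<le> (card A + card B) * (d + 1) ^ 3"
proof -
  \<comment> \<open>The innermost \<open>True\<close> is the relation covered by a single rectangle,
    the case \<open>k = 0\<close>; each comparison then adds one to the exponent.\<close>
  have "\<exists>P. rectangle_cover (\<lambda>a b. ((True \<and> f\<^sub>1 a \<le> g\<^sub>1 b) \<and> f\<^sub>2 a \<le> g\<^sub>2 b) \<and> f\<^sub>3 a \<le> g\<^sub>3 b) A B P \<and>
      weight P \<le> (card A + card B) * (d + 1) ^ Suc (Suc (Suc 0))"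
    by (rule rectangle_cover_compare, rule rectangle_cover_compare, rule rectangle_cover_compare)
      (simp add: rectangle_cover_full, (assumption | rule assms)+)
  then show ?thesis
    by (simp only: simp_thms conj_assoc numeral_3_eq_3)
qed

text \<open>Insert the elements in nondecreasing order of \<open>x\<close> and give each new one a
  rank above all earlier ranks; ties in \<open>x\<close> are thereby broken arbitrarily.\<close>

lemma finite_injective_refinement:
  fixes x :: "'a \<Rightarrow> 'k::linorder"
  assumes "finite S"
  shows "\<exists>\<rho>::'a \<Rightarrow> nat. inj_on \<rho> S \<and> (\<forall>a\<in>S. \<forall>b\<in>S. \<rho> a < \<rho> b \<longrightarrow> x a \<le> x b)"
  using assms
proof (induction S rule: finite_ranking_induct[where f = x])
  case empty
  show ?case by simp
next
  case (insert a S)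
  then obtain \<rho> :: "'a \<Rightarrow> nat" where \<rho>: "inj_on \<rho> S"
    "\<forall>a\<in>S. \<forall>b\<in>S. \<rho> a < \<rho> b \<longrightarrow> x a \<le> x b" by blast
  \<comment> \<open>A sum of naturals bounds each summand, so its successor exceeds every rank in
    use.\<close>
  define N where "N = Suc (\<Sum>b\<in>S. \<rho> b)"
  have less: "\<rho> b < N" if "b \<in> S" for b
    using that insert.hyps member_le_sum[of b S \<rho>] by (simp add: N_def)
  show ?case
  proof (cases "a \<in> S")
    case True
    then show ?thesis using \<rho> by (auto simp: insert_absorb)
  next
    case False
    have "N \<notin> \<rho> ` S"
      using less by blast
    then have "inj_on (\<rho>(a := N)) (insert a S)"
      using \<rho>(1) False by (auto simp: inj_on_fun_updI)
    moreover have "x c \<le> x b"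
      if "c \<in> insert a S" "b \<in> insert a S" "(\<rho>(a := N)) c < (\<rho>(a := N)) b" for c b
      using that \<rho>(2) less insert.hyps False by (force split: if_splits)
    ultimately show ?thesis by blast
  qed
qed

section \<open>From rectangles to bicliques\<close>

definition complete_bipartite_graph :: "'a set \<times> 'a set \<Rightarrow> 'a pair_pre_digraph" where
  "complete_bipartite_graph = (\<lambda>(X, Y). \<lparr>pverts = X \<union> Y, parcs = X \<times> Y \<union> Y \<times> X\<rparr>)"

lemma biclique_complete_bipartite_graph:
  assumes "finite X" "finite Y" "X \<noteq> {}" "Y \<noteq> {}" "X \<inter> Y = {}"
  shows "biclique (complete_bipartite_graph (X, Y))"
  unfolding biclique_def complete_bipartite_digraph_pair_def complete_bipartite_graph_def
  using assms
  by (intro exI[of _ "card X"] exI[of _ "card Y"] conjI exI[of _ X] exI[of _ Y])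
    (auto simp: card_gt_0_iff)

text \<open>\<open>R\<close> selects at least one orientation of each edge, so it need not be
  symmetric; adding the reversed arcs to a rectangle stays inside the symmetric graph
  \<open>G\<close>.\<close>

lemma biclique_cover_of_rectangle_cover:
  assumes G: "pair_graph G"
    and P: "rectangle_cover R (pverts G) (pverts G) P"
    and R: "\<And>a b. a \<in> pverts G \<Longrightarrow> b \<in> pverts G \<Longrightarrow> R a b \<Longrightarrow> (a, b) \<in> parcs G"
    and complete: "\<And>a b. (a, b) \<in> parcs G \<Longrightarrow> R a b \<or> R b a"
  shows "biclique_cover G (complete_bipartite_graph ` P)"
    and "cover_size (complete_bipartite_graph ` P) \<le> weight P"
proof -
  interpret pair_graph G by fact
  have rect: "X \<noteq> {}" "Y \<noteq> {}" "X \<subseteq> pverts G" "Y \<subseteq> pverts G" "X \<times> Y \<subseteq> parcs G"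
    if "(X, Y) \<in> P" for X Y
    using P R that unfolding rectangle_cover_def by fast+
  have sym: "(b, a) \<in> parcs G" if "(a, b) \<in> parcs G" for a b
    using that pair_sym_arcs by (auto simp: symmetric_def dest: symD)
  have "subgraph (with_proj (complete_bipartite_graph (X, Y))) (with_proj G) \<and>
      biclique (complete_bipartite_graph (X, Y))" if "(X, Y) \<in> P" for X Y
  proof
    note r = rect[OF that]
    have "pair_wf_digraph (complete_bipartite_graph (X, Y))"
      by unfold_locales (auto simp: complete_bipartite_graph_def)
    then show "subgraph (with_proj (complete_bipartite_graph (X, Y))) (with_proj G)"
      unfolding subgraph_def wf_digraph_wp_iff compatible_def
      using r sym pair_wf_digraph_axioms by (auto simp: complete_bipartite_graph_def)
    have "finite X" "finite Y"
      using r finite_subset pair_finite_verts by blast+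
    \<comment> \<open>A common vertex would be adjacent to itself.\<close>
    moreover have "X \<inter> Y = {}"
      using r pair_no_loops by fastforce
    ultimately show "biclique (complete_bipartite_graph (X, Y))"
      using r by (intro biclique_complete_bipartite_graph)
  qed
  moreover have "\<exists>H\<in>complete_bipartite_graph ` P. (a, b) \<in> parcs H" if ab: "(a, b) \<in> parcs G" for a b
  proof -
    have "a \<in> pverts G" "b \<in> pverts G"
      using wellformed[OF ab] by simp_all
    then obtain X Y where "(X, Y) \<in> P" "a \<in> X \<and> b \<in> Y \<or> b \<in> X \<and> a \<in> Y"
      using complete[OF ab] P unfolding rectangle_cover_def by blast
    then show ?thesis
      by (intro bexI[OF _ imageI[of "(X, Y)"]]) (auto simp: complete_bipartite_graph_def)
  qed
  ultimately show "biclique_cover G (complete_bipartite_graph ` P)"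
    unfolding biclique_cover_def by auto
  have "finite P"
    using P by (simp add: rectangle_cover_def)
  \<comment> \<open>Only an inequality, since \<open>(X, Y)\<close> and \<open>(Y, X)\<close> give
    the same graph.\<close>
  then have "cover_size (complete_bipartite_graph ` P)
      \<le> (\<Sum>p\<in>P. card (pverts (complete_bipartite_graph p)))"
    unfolding cover_size_def using sum_image_le[of P "\<lambda>H. card (pverts H)" complete_bipartite_graph]
    by (simp add: o_def)
  also have "\<dots> \<le> weight P"
    unfolding weight_def
    by (intro sum_mono) (auto simp: complete_bipartite_graph_def card_Un_le)
  finally show "cover_size (complete_bipartite_graph ` P) \<le> weight P" .
qed

section \<open>Geometry of grounded L-shapes\<close>

lemma closed_segment_right:
  fixes x y a :: real
  assumes "a > 0"
  shows "closed_segment (x, y) ((x, y) + (a, 0)) = {x..x + a} \<times> {y}"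
proof -
  have "closed_segment x (x + a) = {x..x + a}"
    using assms by (simp add: closed_segment_eq_real_ivl)
  then show ?thesis
    by (auto simp: closed_segment_def set_eq_iff algebra_simps)
qed

lemma closed_segment_up:
  fixes x y b :: real
  assumes "b > 0"
  shows "closed_segment (x, y) ((x, y) + (0, b)) = {x} \<times> {y..y + b}"
proof -
  have "closed_segment y (y + b) = {y..y + b}"
    using assms by (simp add: closed_segment_eq_real_ivl)
  then show ?thesis
    by (auto simp: closed_segment_def set_eq_iff algebra_simps)
qed

text \<open>The corner of \<open>L'\<close> lies to the right of and below that of \<open>L\<close>,
  or coincides with it, so the shapes meet iff the horizontal arm of \<open>L\<close> and the
  vertical arm of \<open>L'\<close> meet, at \<open>(x', y)\<close>. The point of the ground line at
  height \<open>y' + b'\<close> has first coordinate \<open>x' + b' / m\<close>.\<close>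

lemma L_shapes_meet_iff:
  fixes m c a b a' b' x x' :: real
  assumes "m < 0" "a > 0" "b > 0" "a' > 0" "b' > 0" "x \<le> x'"
    and "y = m * x + c" "y' = m * x' + c"
    and L: "L = closed_segment (x, y) ((x, y) + (a, 0)) \<union> closed_segment (x, y) ((x, y) + (0, b))"
    and L': "L' = closed_segment (x', y') ((x', y') + (a', 0)) \<union>
      closed_segment (x', y') ((x', y') + (0, b'))"
  shows "L \<inter> L' \<noteq> {} \<longleftrightarrow> x' \<le> x + a \<and> x' + b' / m \<le> x"
proof -
  have y: "y' \<le> y" and y_eq: "y = y' \<longleftrightarrow> x = x'"
    using assms by auto
  have "x' + b' / m \<le> x \<longleftrightarrow> y \<le> y' + b'"
    using assms by (simp add: field_simps)
  moreover have "L \<inter> L' \<noteq> {} \<longleftrightarrow> x' \<le> x + a \<and> y \<le> y' + b'"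
  proof
    assume "x' \<le> x + a \<and> y \<le> y' + b'"
    then have "(x', y) \<in> L \<inter> L'"
      using assms(2-6) y unfolding L L' by (simp add: closed_segment_right closed_segment_up del: add_Pair)
    then show "L \<inter> L' \<noteq> {}" by blast
  next
    assume "L \<inter> L' \<noteq> {}"
    then obtain u v where "(u, v) \<in> L" "(u, v) \<in> L'" by auto
    \<comment> \<open>Any other pair of arms can meet only if the corners coincide, which
      \<open>y_eq\<close> settles.\<close>
    then show "x' \<le> x + a \<and> y \<le> y' + b'"
      using assms(2-6) y y_eq unfolding L L'
      by (auto simp: closed_segment_right closed_segment_up simp del: add_Pair)
  qed
  ultimately show ?thesis by simp
qed

theorem theorem16:
  shows "\<exists>C::real. \<forall>S :: (real \<times> real) set set.
    finite S \<and> (\<forall>L\<in>S. L_shape L) \<and> grounded S \<and> card S \<ge> 2 \<longrightarrow>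
    (\<exists>\<H>. biclique_cover (intersection_graph S) \<H> \<and>
         real (cover_size \<H>) \<le> C * real (card S) * ln (real (card S)) ^ 3)"
\<comment> \<open>The factor 128 is 2 for using \<open>S\<close> on both sides, times
  \<open>4 ^ 3\<close> from \<open>d + 1 \<le> 4 * log 2 (card S)\<close>; \<open>ln 2 ^ 3\<close>
  changes the base of the logarithm.\<close>
proof (rule exI[of _ "128 / ln 2 ^ 3"], intro allI impI)
  fix S :: "(real \<times> real) set set"
  assume "finite S \<and> (\<forall>L\<in>S. L_shape L) \<and> grounded S \<and> card S \<ge> 2"
  then have fin: "finite S" and "grounded S" and n2: "card S \<ge> 2" by auto
  then obtain m c where m: "m < 0"
    and "\<forall>L\<in>S. \<exists>x y. L_shape_with_corner (x, y) L \<and> y = m * x + c"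
    unfolding grounded_def by auto
  then have "\<forall>L\<in>S. \<exists>x a b. a > 0 \<and> b > 0 \<and>
      L = closed_segment (x, m * x + c) ((x, m * x + c) + (a, 0)) \<union>
          closed_segment (x, m * x + c) ((x, m * x + c) + (0, b))"
    unfolding L_shape_with_corner_def by metis
  then obtain x a b where ab: "\<And>L. L \<in> S \<Longrightarrow> a L > 0" "\<And>L. L \<in> S \<Longrightarrow> b L > 0"
    and L: "\<And>L. L \<in> S \<Longrightarrow> L = closed_segment (x L, m * x L + c) ((x L, m * x L + c) + (a L, 0)) \<union>
          closed_segment (x L, m * x L + c) ((x L, m * x L + c) + (0, b L))"
    by metis
  obtain \<rho> :: "(real \<times> real) set \<Rightarrow> nat" where \<rho>: "inj_on \<rho> S"
    "\<forall>K\<in>S. \<forall>L\<in>S. \<rho> K < \<rho> L \<longrightarrow> x K \<le> x L"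
    using finite_injective_refinement[OF fin] by blast
  \<comment> \<open>Breaking ties between equal corners by \<open>\<rho>\<close> makes \<open>R\<close> loop-free, so that the two sides of
    each rectangle are disjoint.\<close>
  define R where "R = (\<lambda>K L. real (\<rho> K) + 1 \<le> real (\<rho> L) \<and>
      - (x K + a K) \<le> - x L \<and> - x K \<le> - (x L + b L / m))"
  have R_iff: "R K L \<longleftrightarrow> \<rho> K < \<rho> L \<and> K \<inter> L \<noteq> {}" if "K \<in> S" "L \<in> S" for K L
  proof (cases "\<rho> K < \<rho> L")
    case True
    then have "x K \<le> x L"
      using \<rho> that by blast
    then have "K \<inter> L \<noteq> {} \<longleftrightarrow> x L \<le> x K + a K \<and> x L + b L / m \<le> x K"
      using that m ab by (intro L_shapes_meet_iff[OF _ _ _ _ _ _ refl refl L L]) auto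
    then show ?thesis
      using True by (auto simp: R_def)
  qed (simp add: R_def)
  define G where "G = intersection_graph S"
  \<comment> \<open>The added 1 accounts for the two copies of \<open>S\<close>.\<close>
  define d where "d = nat \<lceil>log 2 (card S)\<rceil> + 1"
  have log1: "1 \<le> log 2 (card S)"
    using n2 by simp
  have "real (card S) \<le> 2 ^ nat \<lceil>log 2 (card S)\<rceil>"
  proof -
    have "real (card S) = 2 powr log 2 (card S)"
      using n2 by simp
    also have "\<dots> \<le> 2 powr real (nat \<lceil>log 2 (card S)\<rceil>)"
      using log1 by (intro powr_mono) linarith+
    finally show ?thesis
      by (simp add: powr_realpow)
  qed
  then have "card S \<le> 2 ^ nat \<lceil>log 2 (card S)\<rceil>"
    by (metis of_nat_le_iff of_nat_numeral of_nat_power)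
  then have "card S + card S \<le> 2 ^ d"
    by (simp add: d_def)
  \<comment> \<open>Casting the ranks to reals puts all three comparisons in one order; the
    \<open>+ 1\<close> makes the first strict, and the negations put the values of \<open>K\<close>
    on the left.\<close>
  then obtain P where P: "rectangle_cover R S S P" "weight P \<le> (card S + card S) * (d + 1) ^ 3"
    using rectangle_cover_three_comparisons[OF fin fin, of d
        "\<lambda>K. real (\<rho> K) + 1" "\<lambda>L. real (\<rho> L)" "\<lambda>K. - (x K + a K)" "\<lambda>L. - x L"
        "\<lambda>K. - x K" "\<lambda>L. - (x L + b L / m)"]
    unfolding R_def by blast
  have G: "pair_graph G" "pverts G = S"
    using fin by (simp_all add: G_def pair_graph_intersection_graph) (simp add: intersection_graph_def)
  have "(K, L) \<in> parcs G" if "K \<in> S" "L \<in> S" "R K L" for K L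
    using that R_iff by (auto simp: G_def intersection_graph_def)
  moreover have "R K L \<or> R L K" if "(K, L) \<in> parcs G" for K L
  proof -
    have KL: "K \<in> S" "L \<in> S" "K \<noteq> L" "K \<inter> L \<noteq> {}"
      using that by (auto simp: G_def intersection_graph_def)
    then have "\<rho> K < \<rho> L \<or> \<rho> L < \<rho> K"
      using \<rho>(1) by (meson inj_onD linorder_neqE_nat)
    then show ?thesis
      using R_iff KL by (metis Int_commute)
  qed
  ultimately have cover: "biclique_cover G (complete_bipartite_graph ` P)"
    "cover_size (complete_bipartite_graph ` P) \<le> weight P"
    using biclique_cover_of_rectangle_cover[OF G(1), of R P] P(1) G(2) by auto
  \<comment> \<open>Rounding up gives at most \<open>log 2 (card S) + 3\<close>, and the logarithm
    is at least 1.\<close>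
  have "real (d + 1) \<le> 4 * log 2 (card S)"
    using log1 unfolding d_def by linarith
  then have "real (d + 1) ^ 3 \<le> (4 * log 2 (card S)) ^ 3"
    by (intro power_mono) auto
  then have "real (card S + card S) * real (d + 1) ^ 3 \<le>
      real (card S + card S) * (4 * log 2 (card S)) ^ 3"
    by (intro mult_left_mono) auto
  also have "\<dots> = 128 / ln 2 ^ 3 * card S * ln (card S) ^ 3"
    by (simp add: log_def power_divide power_mult_distrib)
  finally have "real (card S + card S) * real (d + 1) ^ 3 \<le> 128 / ln 2 ^ 3 * card S * ln (card S) ^ 3" .
  moreover have "real (cover_size (complete_bipartite_graph ` P)) \<le>
      real (card S + card S) * real (d + 1) ^ 3"
    using order_trans[OF cover(2) P(2)] by (metis of_nat_le_iff of_nat_mult of_nat_power)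
  ultimately show "\<exists>\<H>. biclique_cover (intersection_graph S) \<H> \<and>
      real (cover_size \<H>) \<le> 128 / ln 2 ^ 3 * real (card S) * ln (real (card S)) ^ 3"
    using cover(1) unfolding G_def by (meson order_trans)
qed

end
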